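(* There exist instances $(\mathcal{D},p(\mathcal{M}))$ for which the Bayesian RL objective $$\mathcal{J}(\pi)=\mathbb{E}_{\mathcal{M}\sim p(\mathcal{M}\mid\mathcal{D})}\bigl[\mathcal{J}_{\mathcal{M}}(\pi)\bigr],\qquad \mathcal{J}_{\mathcal{M}}(\pi)=\mathbb{E}_{s_0,\pi}\Bigl[\sum_{t=0}^{T-1} r_{\mathcal{M}}(s_t,a_t)\Bigr],$$ is maximized by a strictly uncertainty-adaptive policy. Moreover, the performance gap between Markovian and strictly uncertainty-adaptive policies can be arbitrarily large.
   Context: **MDPs and instances.** A finite-horizon MDP $\mathcal{M}$ is given by a state space $\mathcal{S}$, an action space $\mathcal{A}$, a horizon $T$, and a reward function $r_{\mathcal{M}}(s,a)$ for $s\in\mathcal{S}$, $a\in\mathcal{A}$, together with its state transitions and initial state $s_0$. An instance $(\mathcal{D},p(\mathcal{M}))$ consists of training data $\mathcal{D}$ (possibly empty) and a prior distribution $p(\mathcal{M})$ over MDPs. Together they define the posterior $p(\mathcal{M}\mid\mathcal{D})\propto p(\mathcal{M})\,p(\mathcal{D}\mid\mathcal{M})$. The agent does not know which MDP it is in. In the objective, $\mathcal{J}_{\mathcal{M}}(\pi)$ is the expected return of policy $\pi$ when run in $\mathcal{M}$, and $\mathcal{J}(\pi)$, the performance of $\pi$, is its average over the posterior. **Histories and policies.** A history is $h_t=(s_0,a_0,r_0,\dots,s_t)$, consisting of the states, actions and rewards observed so far; write $s(h_t)=s_t$ for its final state. A policy $\pi$ assigns to each history $h_t$ a distribution $\pi(\cdot\mid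 h_t)\in\Delta(\mathcal{A})$, where $\Delta(\mathcal{A})$ is the set of probability distributions on $\mathcal{A}$. A policy is Markovian if it depends on the history only through the state: there is $\mu:\mathcal{S}\to\Delta(\mathcal{A})$ with $\pi(\cdot\mid h_t)=\mu(\cdot\mid s(h_t))$ for all $h_t$. **Uncertainty-adaptive policies.** The belief is the posterior over MDPs $b(h_t)(\mathcal{M})=p(\mathcal{M}\mid h_t,\mathcal{D})$. A policy $\pi$ is uncertainty-adaptive if there is a measurable mapping $\mu$ from pairs (state, probability distribution over MDPs) to $\Delta(\mathcal{A})$ such that $\pi(a_t\mid h_t)=\mu(a_t\mid s(h_t),b(h_t))$ for all $h_t$ and $a_t$. If in addition there exist $h_t$ and $h_t'$ with $s(h_t)=s(h_t')$ but $\mu(a_t\mid s(h_t),b(h_t))\neq\mu(a_t\mid s(h_t'),b(h_t'))$, then $\pi$ is strictly uncertainty-adaptive, or equivalently, not Markovian. *)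

theory Defs
  imports "HOL-Probability.Probability"
begin

section \<open>MDPs, instances and histories\<close>

text \<open>The state space, the action space and the horizon are common to all MDPs of an instance, so
  they are fields of the instance; an MDP carries what is specific to it.\<close>

record ('s, 'a) mdp =
  init_state :: 's
  transition :: "'s \<Rightarrow> 'a \<Rightarrow> 's pmf"
  reward :: "'s \<Rightarrow> 'a \<Rightarrow> real"

text \<open>Training data is a finite list of observed transitions \<open>(s, a, r, s')\<close>.\<close>

record ('s, 'a) rl_instance =
  states :: "'s set"
  actions :: "'a set"
  horizon :: nat
  data :: "('s \<times> 'a \<times> real \<times> 's) list"
  prior :: "('s, 'a) mdp pmf"

text \<open>\<open>Step (\<dots> (Step (Start s\<^sub>0) a\<^sub>0 r\<^sub>0 s\<^sub>1) \<dots>) a r s\<close> with \<open>t\<close> steps is the history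
  \<open>h\<^sub>t = (s\<^sub>0, a\<^sub>0, r\<^sub>0, s\<^sub>1, \<dots>, s\<^sub>t)\<close>.\<close>

datatype ('s, 'a) history =
    Start 's
  | Step "('s, 'a) history" 'a real 's

fun last_state :: "('s, 'a) history \<Rightarrow> 's" where
  "last_state (Start s) = s"
| "last_state (Step h a r s) = s"

fun time :: "('s, 'a) history \<Rightarrow> nat" where
  "time (Start s) = 0"
| "time (Step h a r s) = Suc (time h)"

fun actions_of :: "('s, 'a) history \<Rightarrow> 'a set" where
  "actions_of (Start s) = {}"
| "actions_of (Step h a r s) = insert a (actions_of h)"


section \<open>Likelihoods, posterior and belief\<close>

text \<open>Probability that \<open>M\<close> answers action \<open>a\<close> in state \<open>s\<close> with reward \<open>r\<close> and next state \<open>s'\<close>;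
  rewards are deterministic given \<open>(s, a)\<close>.\<close>

definition step_likelihood :: "('s, 'a) mdp \<Rightarrow> 's \<Rightarrow> 'a \<Rightarrow> real \<Rightarrow> 's \<Rightarrow> real" where
  "step_likelihood M s a r s' = of_bool (r = reward M s a) * pmf (transition M s a) s'"

text \<open>The probabilities with which actions are chosen (by the policy, or by whoever collected the
  data) do not depend on the MDP and cancel in Bayes' rule, so they are left out of the two
  likelihoods below.\<close>

definition data_likelihood :: "('s \<times> 'a \<times> real \<times> 's) list \<Rightarrow> ('s, 'a) mdp \<Rightarrow> real" where
  "data_likelihood D M = (\<Prod>(s, a, r, s')\<leftarrow>D. step_likelihood M s a r s')"

fun history_likelihood :: "('s, 'a) history \<Rightarrow> ('s, 'a) mdp \<Rightarrow> real" where
  "history_likelihood (Start s) M = of_bool (s = init_state M)"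
| "history_likelihood (Step h a r s) M =
     history_likelihood h M * step_likelihood M (last_state h) a r s"

text \<open>Bayes' rule for prior \<open>p\<close> and likelihood \<open>L\<close>. It is meaningful only if some point of the
  support of \<open>p\<close> has positive likelihood; see \<open>pmf_bayes\<close>.\<close>

definition bayes :: "'m pmf \<Rightarrow> ('m \<Rightarrow> real) \<Rightarrow> 'm pmf" where
  "bayes p L = embed_pmf (\<lambda>m. pmf p m * L m / measure_pmf.expectation p L)"

lemma pmf_bayes:
  assumes L: "\<And>m. 0 \<le> L m" "\<And>m. L m \<le> 1" and pos: "\<exists>m\<in>set_pmf p. L m > 0"
  shows "pmf (bayes p L) m = pmf p m * L m / measure_pmf.expectation p L"
proof -
  define c where "c = measure_pmf.expectation p L"
  have int: "integrable (measure_pmf p) L"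
    by (rule measure_pmf.integrable_const_bound[where B = 1]) (auto simp: L)
  have "c \<noteq> 0"
  proof
    assume "c = 0"
    then have "AE m in measure_pmf p. L m = 0"
      unfolding c_def using integral_nonneg_eq_0_iff_AE[OF int] L(1) by simp
    with pos show False by (auto simp: AE_measure_pmf_iff)
  qed
  moreover have "c \<ge> 0" unfolding c_def by (intro integral_nonneg_AE) (simp add: L)
  ultimately have c: "c > 0" by simp
  have "(\<integral>\<^sup>+ m. ennreal (pmf p m * L m / c) \<partial>count_space UNIV)
      = (\<integral>\<^sup>+ m. ennreal (pmf p m) * ennreal (L m / c) \<partial>count_space UNIV)"
    using c L by (intro nn_integral_cong) (simp add: ennreal_mult[symmetric])
  also have "\<dots> = (\<integral>\<^sup>+ m. ennreal (L m / c) \<partial>measure_pmf p)"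
    by (simp add: nn_integral_measure_pmf)
  also have "\<dots> = ennreal (\<integral> m. L m / c \<partial>measure_pmf p)"
    using c L int by (intro nn_integral_eq_integral) auto
  also have "\<dots> = 1" using c by (simp add: c_def)
  finally show ?thesis
    unfolding bayes_def c_def[symmetric] using c L by (subst pmf_embed_pmf) auto
qed

definition posterior :: "('s, 'a) rl_instance \<Rightarrow> ('s, 'a) mdp pmf" where
  "posterior I = bayes (prior I) (data_likelihood (data I))"

definition belief :: "('s, 'a) rl_instance \<Rightarrow> ('s, 'a) history \<Rightarrow> ('s, 'a) mdp pmf" where
  "belief I h = bayes (prior I) (\<lambda>M. data_likelihood (data I) M * history_likelihood h M)"


section \<open>Well-formed instances\<close>

definition is_mdp :: "'s set \<Rightarrow> 'a set \<Rightarrow> ('s, 'a) mdp \<Rightarrow> bool" where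
  "is_mdp S A M \<longleftrightarrow>
     init_state M \<in> S \<and> (\<forall>s\<in>S. \<forall>a\<in>A. set_pmf (transition M s a) \<subseteq> S)"

text \<open>Countability makes probability mass functions the general probability distributions on the
  state and action spaces. The data must be possible under the prior, so that the posterior exists,
  and uniformly bounded rewards make all expected returns exist.\<close>

definition valid_instance :: "('s, 'a) rl_instance \<Rightarrow> bool" where
  "valid_instance I \<longleftrightarrow>
     countable (states I) \<and> countable (actions I) \<and> actions I \<noteq> {} \<and>
     (\<forall>M\<in>set_pmf (prior I). is_mdp (states I) (actions I) M) \<and>
     (\<exists>B. \<forall>M\<in>set_pmf (prior I). \<forall>s\<in>states I. \<forall>a\<in>actions I. \<bar>reward M s a\<bar> \<le> B) \<and>
     set (data I) \<subseteq> states I \<times> actions I \<times> UNIV \<times> states I \<and>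
     (\<exists>M\<in>set_pmf (prior I). data_likelihood (data I) M > 0)"

text \<open>The histories at which an action is taken (\<open>t < T\<close>) and that can occur, under some choice of
  actions, in an MDP of positive posterior probability. Exactly for these is the belief defined.\<close>

definition histories :: "('s, 'a) rl_instance \<Rightarrow> ('s, 'a) history set" where
  "histories I = {h. time h < horizon I \<and> actions_of h \<subseteq> actions I \<and>
     (\<exists>M\<in>set_pmf (prior I). data_likelihood (data I) M * history_likelihood h M > 0)}"


section \<open>Policies\<close>

definition dists_on :: "'x set \<Rightarrow> 'x pmf set" where
  "dists_on X = {q. set_pmf q \<subseteq> X}"

text \<open>The \<open>\<sigma>\<close>-algebra on distributions is the usual one, generated by the evaluations
  \<open>q \<mapsto> q(X)\<close>.\<close>

definition pmf_algebra :: "'x pmf measure" where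
  "pmf_algebra = vimage_algebra UNIV measure_pmf (prob_algebra (count_space UNIV))"

type_synonym ('s, 'a) policy = "('s, 'a) history \<Rightarrow> 'a pmf"

definition is_policy :: "('s, 'a) rl_instance \<Rightarrow> ('s, 'a) policy \<Rightarrow> bool" where
  "is_policy I \<pi> \<longleftrightarrow> (\<forall>h\<in>histories I. \<pi> h \<in> dists_on (actions I))"

definition markovian :: "('s, 'a) rl_instance \<Rightarrow> ('s, 'a) policy \<Rightarrow> bool" where
  "markovian I \<pi> \<longleftrightarrow> is_policy I \<pi> \<and>
     (\<exists>\<mu>. (\<forall>s\<in>states I. \<mu> s \<in> dists_on (actions I)) \<and>
          (\<forall>h\<in>histories I. \<pi> h = \<mu> (last_state h)))"

definition adaptive_via ::
  "('s, 'a) rl_instance \<Rightarrow> ('s \<times> ('s, 'a) mdp pmf \<Rightarrow> 'a pmf) \<Rightarrow> ('s, 'a) policy \<Rightarrow> bool" where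
  "adaptive_via I \<mu> \<pi> \<longleftrightarrow> is_policy I \<pi> \<and>
     \<mu> \<in> count_space (states I) \<Otimes>\<^sub>M pmf_algebra \<rightarrow>\<^sub>M
           restrict_space pmf_algebra (dists_on (actions I)) \<and>
     (\<forall>h\<in>histories I. \<pi> h = \<mu> (last_state h, belief I h))"

definition uncertainty_adaptive :: "('s, 'a) rl_instance \<Rightarrow> ('s, 'a) policy \<Rightarrow> bool" where
  "uncertainty_adaptive I \<pi> \<longleftrightarrow> (\<exists>\<mu>. adaptive_via I \<mu> \<pi>)"

definition strictly_uncertainty_adaptive ::
  "('s, 'a) rl_instance \<Rightarrow> ('s, 'a) policy \<Rightarrow> bool" where
  "strictly_uncertainty_adaptive I \<pi> \<longleftrightarrow>
     (\<exists>\<mu>. adaptive_via I \<mu> \<pi> \<and>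
        (\<exists>h\<in>histories I. \<exists>h'\<in>histories I. \<exists>a\<in>actions I. last_state h = last_state h' \<and>
           pmf (\<mu> (last_state h, belief I h)) a \<noteq> pmf (\<mu> (last_state h', belief I h')) a))"

lemma strictly_uncertainty_adaptive_iff:
  assumes "valid_instance I"
  shows "strictly_uncertainty_adaptive I \<pi> \<longleftrightarrow> uncertainty_adaptive I \<pi> \<and> \<not> markovian I \<pi>"
proof (intro iffI conjI)
  assume strict: "strictly_uncertainty_adaptive I \<pi>"
  then show "uncertainty_adaptive I \<pi>"
    by (auto simp: strictly_uncertainty_adaptive_def uncertainty_adaptive_def)
  from strict obtain \<mu> h h' a where "adaptive_via I \<mu> \<pi>"
    and h: "h \<in> histories I" "h' \<in> histories I" "last_state h = last_state h'"
    and ne: "pmf (\<mu> (last_state h, belief I h)) a \<noteq> pmf (\<mu> (last_state h', belief I h')) a"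
    unfolding strictly_uncertainty_adaptive_def by blast
  then have "\<pi> h = \<mu> (last_state h, belief I h)" "\<pi> h' = \<mu> (last_state h', belief I h')"
    by (auto simp: adaptive_via_def)
  with ne have "\<pi> h \<noteq> \<pi> h'" by auto
  then show "\<not> markovian I \<pi>"
    using h by (auto simp: markovian_def)
next
  assume *: "uncertainty_adaptive I \<pi> \<and> \<not> markovian I \<pi>"
  then obtain \<mu> where \<mu>: "adaptive_via I \<mu> \<pi>" by (auto simp: uncertainty_adaptive_def)
  then have pol: "is_policy I \<pi>"
    and \<pi>: "\<And>h. h \<in> histories I \<Longrightarrow> \<pi> h = \<mu> (last_state h, belief I h)"
    by (auto simp: adaptive_via_def)
  have "\<exists>h\<in>histories I. \<exists>h'\<in>histories I. last_state h = last_state h' \<and> \<pi> h \<noteq> \<pi> h'"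
  proof (rule ccontr)
    assume "\<not> ?thesis"
    then have eq: "\<pi> h = \<pi> h'"
      if "h \<in> histories I" "h' \<in> histories I" "last_state h = last_state h'" for h h'
      using that by blast
    obtain a where a: "a \<in> actions I" using assms by (auto simp: valid_instance_def)
    define m where "m s = (if \<exists>h\<in>histories I. last_state h = s
      then \<pi> (SOME h. h \<in> histories I \<and> last_state h = s) else return_pmf a)" for s
    have some: "(SOME h'. h' \<in> histories I \<and> last_state h' = s) \<in> histories I \<and>
        last_state (SOME h'. h' \<in> histories I \<and> last_state h' = s) = s"
      if "\<exists>h\<in>histories I. last_state h = s" for s
      using that by (intro someI_ex[of "\<lambda>h'. h' \<in> histories I \<and> last_state h' = s"]) blast
    have "m s \<in> dists_on (actions I)" for s
      using some[of s] pol a by (auto simp: m_def is_policy_def dists_on_def)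
    moreover have "\<pi> h = m (last_state h)" if "h \<in> histories I" for h
    proof -
      let ?h = "SOME h'. h' \<in> histories I \<and> last_state h' = last_state h"
      have "?h \<in> histories I \<and> last_state ?h = last_state h" using that by (intro some) blast
      then have "\<pi> h = \<pi> ?h" by (intro eq that) auto
      also have "\<dots> = m (last_state h)" using that unfolding m_def by (subst if_P) auto
      finally show ?thesis .
    qed
    ultimately have "markovian I \<pi>" using pol unfolding markovian_def by blast
    with * show False by blast
  qed
  then obtain h h' where h: "h \<in> histories I" "h' \<in> histories I" "last_state h = last_state h'"
    "\<pi> h \<noteq> \<pi> h'" by blast
  then obtain a where a: "pmf (\<pi> h) a \<noteq> pmf (\<pi> h') a" by (meson pmf_eqI)
  then have "a \<in> set_pmf (\<pi> h) \<or> a \<in> set_pmf (\<pi> h')" by (auto simp: set_pmf_iff)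
  then have "a \<in> actions I" using pol h by (auto simp: is_policy_def dists_on_def)
  moreover have "pmf (\<mu> (last_state h, belief I h)) a \<noteq> pmf (\<mu> (last_state h', belief I h')) a"
    using a \<pi>[OF h(1)] \<pi>[OF h(2)] by simp
  ultimately show "strictly_uncertainty_adaptive I \<pi>"
    unfolding strictly_uncertainty_adaptive_def using \<mu> h(1-3) by blast
qed


section \<open>Performance\<close>

text \<open>Distribution of the history \<open>h\<^sub>t\<close> when policy \<open>\<pi>\<close> is run in \<open>M\<close>.\<close>

fun run :: "('s, 'a) mdp \<Rightarrow> ('s, 'a) policy \<Rightarrow> nat \<Rightarrow> ('s, 'a) history pmf" where
  "run M \<pi> 0 = return_pmf (Start (init_state M))"
| "run M \<pi> (Suc t) = do {
     h \<leftarrow> run M \<pi> t;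
     a \<leftarrow> \<pi> h;
     s \<leftarrow> transition M (last_state h) a;
     return_pmf (Step h a (reward M (last_state h) a) s)
   }"

fun total_reward :: "('s, 'a) mdp \<Rightarrow> ('s, 'a) history \<Rightarrow> real" where
  "total_reward M (Start s) = 0"
| "total_reward M (Step h a r s) = total_reward M h + reward M (last_state h) a"

definition mdp_performance :: "nat \<Rightarrow> ('s, 'a) policy \<Rightarrow> ('s, 'a) mdp \<Rightarrow> real" where
  "mdp_performance T \<pi> M = measure_pmf.expectation (run M \<pi> T) (total_reward M)"

definition performance :: "('s, 'a) rl_instance \<Rightarrow> ('s, 'a) policy \<Rightarrow> real" where
  "performance I \<pi> = measure_pmf.expectation (posterior I) (mdp_performance (horizon I) \<pi>)"

definition maximizes_performance :: "('s, 'a) rl_instance \<Rightarrow> ('s, 'a) policy \<Rightarrow> bool" where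
  "maximizes_performance I \<pi> \<longleftrightarrow>
     is_policy I \<pi> \<and> (\<forall>\<pi>'. is_policy I \<pi>' \<longrightarrow> performance I \<pi>' \<le> performance I \<pi>)"

end

theory Submission
  imports Defs
begin

text \<open>A two-armed bandit with a single state and horizon 2: it is equally likely that arm 0 or arm 1
  pays \<open>c\<close>, and the other arm pays nothing. By symmetry the first pull earns \<open>c / 2\<close> on average
  whatever the policy, and its reward reveals the good arm. A belief-based policy therefore earns
  \<open>c\<close> with the second pull, which is best possible, whereas a Markovian policy
  must repeat its first action distribution and again earns only \<open>c / 2\<close>. The gap is \<open>c / 2\<close>.\<close>

definition bandit :: "real \<Rightarrow> nat \<Rightarrow> (nat, nat) mdp" where
  "bandit c i = \<lparr>init_state = 0, transition = (\<lambda>s a. return_pmf 0),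
     reward = (\<lambda>s a. if a = i then c else 0)\<rparr>"

definition bandit_instance :: "real \<Rightarrow> (nat, nat) rl_instance" where
  "bandit_instance c = \<lparr>states = {0}, actions = {0, 1}, horizon = 2, data = [],
     prior = pmf_of_set {bandit c 0, bandit c 1}\<rparr>"

text \<open>The strict threshold settles the tie at the uniform initial belief in favour of arm 0.
  Reading the belief through a single point mass keeps measurability easy.\<close>

definition follow_belief :: "real \<Rightarrow> nat \<times> (nat, nat) mdp pmf \<Rightarrow> nat pmf" where
  "follow_belief c = (\<lambda>(s, b). return_pmf (if pmf b (bandit c 1) > 1 / 2 then 1 else 0))"

definition adaptive_policy :: "real \<Rightarrow> (nat, nat) policy" where
  "adaptive_policy c h = follow_belief c (last_state h, belief (bandit_instance c) h)"

lemma bandit_simps [simp]: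
  "init_state (bandit c i) = 0"
  "transition (bandit c i) s a = return_pmf 0"
  "reward (bandit c i) s a = (if a = i then c else 0)"
  by (simp_all add: bandit_def)

lemma bandit_instance_simps [simp]:
  "states (bandit_instance c) = {0}"
  "actions (bandit_instance c) = {0, 1}"
  "horizon (bandit_instance c) = 2"
  "data (bandit_instance c) = []"
  "prior (bandit_instance c) = pmf_of_set {bandit c 0, bandit c 1}"
  by (simp_all add: bandit_instance_def)

lemma data_likelihood_Nil [simp]: "data_likelihood [] = (\<lambda>_. 1)"
  by (simp add: data_likelihood_def fun_eq_iff)

lemma bayes_const_one: "bayes p (\<lambda>_. 1) = p"
proof (rule pmf_eqI)
  fix m
  show "pmf (bayes p (\<lambda>_. 1)) m = pmf p m"
    by (subst pmf_bayes) (auto simp: set_pmf_not_empty ex_in_conv)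
qed

text \<open>The reward of arm \<open>i\<close> tells the two MDPs apart. At \<open>c = 0\<close>
  they coincide and the prior collapses to one point, hence the hypothesis
  \<open>c \<noteq> 0\<close> from here on.\<close>

lemma bandit_eq_iff: "c \<noteq> 0 \<Longrightarrow> bandit c i = bandit c j \<longleftrightarrow> i = j"
  by (metis bandit_simps(3))

lemma valid_bandit_instance: "valid_instance (bandit_instance c)"
  unfolding valid_instance_def is_mdp_def
  by (auto simp: step_likelihood_def intro!: exI[of _ "\<bar>c\<bar>"])

lemma history_likelihood_01: "history_likelihood h M \<in> {0..1}"
  by (induction h) (auto simp: step_likelihood_def pmf_le_1 mult_le_one)

text \<open>The uniform prior weights cancel in Bayes' rule, leaving normalised likelihoods. The
  assumption \<open>pos\<close> puts a bandit of positive likelihood into the support, as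
  \<open>pmf_bayes\<close> demands.\<close>

lemma pmf_belief_bandit:
  assumes "c \<noteq> 0" and i: "i \<in> {0, 1}"
    and pos: "history_likelihood h (bandit c 0) + history_likelihood h (bandit c 1) > 0"
  shows "pmf (belief (bandit_instance c) h) (bandit c i) =
    history_likelihood h (bandit c i) /
      (history_likelihood h (bandit c 0) + history_likelihood h (bandit c 1))"
proof -
  have "\<exists>m\<in>set_pmf (prior (bandit_instance c)). history_likelihood h m > 0"
    using pos by (auto simp: not_less dest: add_nonpos_nonpos)
  then show ?thesis
    unfolding belief_def using history_likelihood_01[of h] i bandit_eq_iff[OF assms(1)]
    by (subst pmf_bayes) (auto simp: integral_pmf_of_set pmf_of_set)
qed

text \<open>\<open>measure_pmf\<close> is measurable by construction of the pulled-back algebra, and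
  evaluating a subprobability measure at the set \<open>{x}\<close> is measurable; the composition
  is the point mass at \<open>x\<close>.\<close>

lemma pmf_measurable: "(\<lambda>q. pmf q x) \<in> borel_measurable pmf_algebra"
proof -
  have "measure_pmf \<in> pmf_algebra \<rightarrow>\<^sub>M prob_algebra (count_space UNIV)"
    unfolding pmf_algebra_def
    by (rule measurable_vimage_algebra1)
      (auto simp: space_prob_algebra measure_pmf.prob_space_axioms)
  then have "measure_pmf \<in> pmf_algebra \<rightarrow>\<^sub>M subprob_algebra (count_space UNIV)"
    by (rule measurable_prob_algebraD)
  from measurable_compose[OF this measurable_measure_subprob_algebra[of "{x}"]]
  show ?thesis by (simp add: measure_pmf_single)
qed

text \<open>The decision rule switches between two constants on a set cut out by a measurable
  function of the belief.\<close>

lemma adaptive_via_follow_belief: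
  "adaptive_via (bandit_instance c) (follow_belief c) (adaptive_policy c)"
proof -
  let ?M = "count_space {0} \<Otimes>\<^sub>M pmf_algebra :: (nat \<times> (nat, nat) mdp pmf) measure"
  have [measurable]: "(\<lambda>x. pmf (snd x) (bandit c 1)) \<in> borel_measurable ?M"
    by (rule measurable_compose[OF measurable_snd pmf_measurable])
  have "(\<lambda>x. if pmf (snd x) (bandit c 1) > 1 / 2 then return_pmf 1 else return_pmf 0)
      \<in> ?M \<rightarrow>\<^sub>M restrict_space pmf_algebra (dists_on {0, 1})"
  proof (rule measurable_If)
    show "{x \<in> space ?M. pmf (snd x) (bandit c 1) > 1 / 2} \<in> sets ?M"
      by measurable
  qed (auto simp: space_restrict_space pmf_algebra_def dists_on_def)
  also have "(\<lambda>x. if pmf (snd x) (bandit c 1) > 1 / 2 then return_pmf 1 else return_pmf 0) =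
      follow_belief c"
    by (auto simp: follow_belief_def)
  finally show ?thesis
    by (auto simp: adaptive_via_def is_policy_def dists_on_def adaptive_policy_def
        follow_belief_def)
qed

lemma is_policy_adaptive_policy: "is_policy (bandit_instance c) (adaptive_policy c)"
  using adaptive_via_follow_belief by (simp add: adaptive_via_def)

lemma adaptive_policy_Start: "c \<noteq> 0 \<Longrightarrow> adaptive_policy c (Start 0) = return_pmf 0"
  by (simp add: adaptive_policy_def follow_belief_def pmf_belief_bandit)

text \<open>Since \<open>c \<noteq> 0\<close>, the reward of either arm has likelihood 1 under the
  true bandit and 0 under the other, so the belief is a point mass after one pull.\<close>

lemma adaptive_policy_Step:
  assumes "c \<noteq> 0" "a \<in> {0, 1}" "i \<in> {0, 1}"
  shows "adaptive_policy c (Step (Start 0) a (if a = i then c else 0) 0) = return_pmf i"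
  using assms
  by (auto simp: adaptive_policy_def follow_belief_def pmf_belief_bandit step_likelihood_def)

text \<open>Policies are constrained only on \<open>histories\<close>. With horizon 2, this history
  and those of the next lemma are all the decision points.\<close>

lemma Start_in_histories: "Start 0 \<in> histories (bandit_instance c)"
  by (auto simp: histories_def)

lemma Step_in_histories:
  "a \<in> {0, 1} \<Longrightarrow> i \<in> {0, 1} \<Longrightarrow>
    Step (Start 0) a (if a = i then c else 0) 0 \<in> histories (bandit_instance c)"
  by (auto simp: histories_def step_likelihood_def)

lemma strictly_uncertainty_adaptive_adaptive_policy:
  assumes "c \<noteq> 0"
  shows "strictly_uncertainty_adaptive (bandit_instance c) (adaptive_policy c)"
proof -
  \<comment> \<open>The witnesses share the state 0: the policy starts with arm 0 but turns to arm 1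
    once arm 0 has paid nothing.\<close>
  have "adaptive_policy c (Step (Start 0) 0 0 0) = return_pmf 1"
    using adaptive_policy_Step[OF assms, of 0 1] by simp
  moreover have "Step (Start 0) 0 0 0 \<in> histories (bandit_instance c)"
    using Step_in_histories[of 0 1 c] by simp
  ultimately show ?thesis
    unfolding strictly_uncertainty_adaptive_def
    using adaptive_via_follow_belief[of c] Start_in_histories[of c] adaptive_policy_Start[OF assms]
    by (intro exI[of _ "follow_belief c"] conjI bexI[of _ "Start 0"]
        bexI[of _ "Step (Start 0) 0 0 0"] bexI[of _ 0])
      (auto simp: adaptive_policy_def)
qed

lemma sum_pmf_01:
  "set_pmf q \<subseteq> {0, 1 :: nat} \<Longrightarrow> pmf q 0 + pmf q 1 = 1"
  using sum_pmf_eq_1[of "{0, 1}" q] by simp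

lemma mdp_performance_bandit:
  assumes pol: "is_policy (bandit_instance c) \<pi>" and i: "i \<in> {0, 1}"
  shows "mdp_performance 2 \<pi> (bandit c i) = c * (pmf (\<pi> (Start 0)) i +
    (\<Sum>a\<in>{0, 1}. pmf (\<pi> (Start 0)) a *
       pmf (\<pi> (Step (Start 0) a (if a = i then c else 0) 0)) i))"
proof -
  let ?h = "\<lambda>a. Step (Start 0) a (if a = i then c else 0) 0"
  let ?q = "\<pi> (Start 0)"
  have q: "set_pmf ?q \<subseteq> {0, 1}"
    using pol Start_in_histories[of c] by (auto simp: is_policy_def dists_on_def)
  have h: "set_pmf (\<pi> (?h a)) \<subseteq> {0, 1}" if "a \<in> {0, 1}" for a
    using pol Step_in_histories[OF that i, of c] by (auto simp: is_policy_def dists_on_def)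
  let ?g = "\<lambda>a. \<pi> (?h a) \<bind> (\<lambda>a'. return_pmf (Step (?h a) a' (if a' = i then c else 0) 0))"
  let ?R = "total_reward (bandit c i)"
  have run: "run (bandit c i) \<pi> 2 = bind_pmf ?q ?g"
    by (simp add: numeral_2_eq_2 bind_return_pmf bind_assoc_pmf)
  have inner: "measure_pmf.expectation (?g a) ?R =
      (if a = i then c else 0) + c * pmf (\<pi> (?h a)) i" if a: "a \<in> {0, 1}" for a
  proof -
    have "measure_pmf.expectation (?g a) ?R = (\<Sum>a'\<in>{0, 1}. pmf (\<pi> (?h a)) a' *
        ((if a = i then c else 0) + (if a' = i then c else 0)))"
      using h[OF a] by (subst pmf_expectation_bind[of "{0, 1}"]) auto
    \<comment> \<open>The reward of the first pull does not depend on \<open>a'\<close>, so it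
      factors out against a total probability of 1.\<close>
    also have "\<dots> = (if a = i then c else 0) * (pmf (\<pi> (?h a)) 0 + pmf (\<pi> (?h a)) 1) +
        c * pmf (\<pi> (?h a)) i"
      using i by (auto simp: algebra_simps)
    finally show ?thesis
      by (simp only: sum_pmf_01[OF h[OF a]] mult_1_right)
  qed
  have fin: "finite (set_pmf (?g a))" if "a \<in> {0, 1}" for a
    using finite_subset[OF h[OF that]] by simp
  have "mdp_performance 2 \<pi> (bandit c i) =
      (\<Sum>a\<in>{0, 1}. pmf ?q a * measure_pmf.expectation (?g a) ?R)"
    \<comment> \<open>The products become scalar multiples to match the form of
      \<open>pmf_expectation_bind\<close>.\<close>
    unfolding mdp_performance_def run real_scaleR_def[symmetric]
    by (rule pmf_expectation_bind[OF _ fin q]) simp_all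
  also have "\<dots> = (\<Sum>a\<in>{0, 1}. pmf ?q a * ((if a = i then c else 0) + c * pmf (\<pi> (?h a)) i))"
    by (intro sum.cong refl) (simp only: inner)
  also have "\<dots> = c * (pmf ?q i + (\<Sum>a\<in>{0, 1}. pmf ?q a * pmf (\<pi> (?h a)) i))"
    using i by (auto simp: algebra_simps)
  finally show ?thesis .
qed

text \<open>Averaging over the good arm \<open>i\<close> adds up the first-pull probabilities to the
  summand 1; the policy influences only the double sum, the success probabilities of the second
  pull.\<close>

lemma performance_bandit_instance:
  assumes "c \<noteq> 0" and pol: "is_policy (bandit_instance c) \<pi>"
  shows "performance (bandit_instance c) \<pi> = c / 2 * (1 + (\<Sum>i\<in>{0, 1}. \<Sum>a\<in>{0, 1}.
    pmf (\<pi> (Start 0)) a * pmf (\<pi> (Step (Start 0) a (if a = i then c else 0) 0)) i))"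
proof -
  have post: "posterior (bandit_instance c) = pmf_of_set {bandit c 0, bandit c 1}"
    by (simp add: posterior_def bayes_const_one)
  have "set_pmf (\<pi> (Start 0)) \<subseteq> {0, 1}"
    using pol Start_in_histories[of c] by (auto simp: is_policy_def dists_on_def)
  note q = sum_pmf_01[OF this]
  have "performance (bandit_instance c) \<pi> =
      (mdp_performance 2 \<pi> (bandit c 0) + mdp_performance 2 \<pi> (bandit c 1)) / 2"
    using bandit_eq_iff[OF assms(1), of 0 1]
    by (simp add: performance_def post integral_pmf_of_set)
  also have "\<dots> = c / 2 * (pmf (\<pi> (Start 0)) 0 + pmf (\<pi> (Start 0)) 1 +
    (\<Sum>i\<in>{0, 1}. \<Sum>a\<in>{0, 1}.
    pmf (\<pi> (Start 0)) a * pmf (\<pi> (Step (Start 0) a (if a = i then c else 0) 0)) i))"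
    by (simp add: mdp_performance_bandit[OF pol] field_simps)
  finally show ?thesis using q by simp
qed

lemma performance_le:
  assumes "c > 0" and pol: "is_policy (bandit_instance c) \<pi>"
  shows "performance (bandit_instance c) \<pi> \<le> 3 / 2 * c"
proof -
  have q: "set_pmf (\<pi> (Start 0)) \<subseteq> {0, 1}"
    using pol Start_in_histories[of c] by (auto simp: is_policy_def dists_on_def)
  have "(\<Sum>i\<in>{0, 1}. \<Sum>a\<in>{0, 1}.
      pmf (\<pi> (Start 0)) a * pmf (\<pi> (Step (Start 0) a (if a = i then c else 0) 0)) i)
    \<le> (\<Sum>i\<in>{0, 1 :: nat}. \<Sum>a\<in>{0, 1}. pmf (\<pi> (Start 0)) a * 1)" (is "?S \<le> _")
    \<comment> \<open>Second-pull probabilities are at most 1, and the first-pull weights sum to 1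
      for each of the two values of \<open>i\<close>.\<close>
    by (intro sum_mono mult_left_mono pmf_le_1 pmf_nonneg)
  also have "\<dots> = 2"
    using sum_pmf_01[OF q] by simp
  finally have "c / 2 * (1 + ?S) \<le> c / 2 * 3"
    using assms(1) by (intro mult_left_mono) auto
  moreover have "performance (bandit_instance c) \<pi> = c / 2 * (1 + ?S)"
    using assms(1) by (intro performance_bandit_instance[OF _ pol]) simp
  ultimately show ?thesis by simp
qed

lemma performance_adaptive_policy:
  assumes "c \<noteq> 0"
  shows "performance (bandit_instance c) (adaptive_policy c) = 3 / 2 * c"
proof -
  \<comment> \<open>The first pull is surely arm 0, so only the terms with \<open>a = 0\<close>
    survive; each equals 1, and the double sum attains its bound 2.\<close>
  have "adaptive_policy c (Step (Start 0) 0 (if 0 = i then c else 0) 0) = return_pmf i"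
    if "i \<in> {0, 1}" for i
    using adaptive_policy_Step[OF assms _ that, of 0] by simp
  note step = this[of 0] this[of 1]
  have sum_01: "(\<Sum>i\<in>{0, 1}. f i) = f 0 + f 1" for f :: "nat \<Rightarrow> real"
    by simp
  show ?thesis
    unfolding performance_bandit_instance[OF assms is_policy_adaptive_policy]
      adaptive_policy_Start[OF assms] sum_01 using step by simp
qed

lemma performance_markovian:
  assumes "c \<noteq> 0" and "markovian (bandit_instance c) \<pi>"
  shows "performance (bandit_instance c) \<pi> = c"
proof -
  obtain \<mu> where pol: "is_policy (bandit_instance c) \<pi>"
    and \<mu>: "\<And>h. h \<in> histories (bandit_instance c) \<Longrightarrow> \<pi> h = \<mu> (last_state h)"
    using assms(2) by (auto simp: markovian_def)
  have q: "set_pmf (\<pi> (Start 0)) \<subseteq> {0, 1}"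
    using pol Start_in_histories[of c] by (auto simp: is_policy_def dists_on_def)
  \<comment> \<open>All histories end in the only state, so the second pull repeats the first
    distribution and the double sum becomes the square of a total probability.\<close>
  have "\<pi> (Step (Start 0) a (if a = i then c else 0) 0) = \<pi> (Start 0)"
    if "a \<in> {0, 1}" "i \<in> {0, 1}" for a i
    using \<mu>[OF Step_in_histories[OF that]] \<mu>[OF Start_in_histories] by simp
  then have "(\<Sum>i\<in>{0, 1}. \<Sum>a\<in>{0, 1}.
      pmf (\<pi> (Start 0)) a * pmf (\<pi> (Step (Start 0) a (if a = i then c else 0) 0)) i) =
    (\<Sum>i\<in>{0, 1}. \<Sum>a\<in>{0, 1}. pmf (\<pi> (Start 0)) a * pmf (\<pi> (Start 0)) i)"
    by (intro sum.cong refl) simp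
  also have "\<dots> = (pmf (\<pi> (Start 0)) 0 + pmf (\<pi> (Start 0)) 1)\<^sup>2"
    by (simp add: power2_eq_square algebra_simps)
  finally show ?thesis
    by (simp add: performance_bandit_instance[OF assms(1) pol] sum_pmf_01[OF q, simplified])
qed

theorem theorem4p3:
  "(\<exists>I :: (nat, nat) rl_instance. valid_instance I \<and>
      (\<exists>\<pi>. strictly_uncertainty_adaptive I \<pi> \<and> maximizes_performance I \<pi>)) \<and>
   (\<forall>K :: real. \<exists>I :: (nat, nat) rl_instance. valid_instance I \<and>
      (\<exists>\<pi>. strictly_uncertainty_adaptive I \<pi> \<and> maximizes_performance I \<pi> \<and>
         (\<forall>\<pi>'. markovian I \<pi>' \<longrightarrow> performance I \<pi> - performance I \<pi>' \<ge> K)))"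
proof -
  have gap: "\<exists>I :: (nat, nat) rl_instance. valid_instance I \<and>
      (\<exists>\<pi>. strictly_uncertainty_adaptive I \<pi> \<and> maximizes_performance I \<pi> \<and>
         (\<forall>\<pi>'. markovian I \<pi>' \<longrightarrow> performance I \<pi> - performance I \<pi>' \<ge> K))" for K :: real
  proof -
    \<comment> \<open>The gap is \<open>3 / 2 * c - c = c / 2\<close>; the absolute value and the
      added 1 keep \<open>c\<close> positive for every sign of \<open>K\<close>.\<close>
    define c where "c = 2 * \<bar>K\<bar> + 1"
    have c: "c > 0" "c \<noteq> 0" "K \<le> c / 2" by (auto simp: c_def)
    have "maximizes_performance (bandit_instance c) (adaptive_policy c)"
      using performance_le[OF c(1)] is_policy_adaptive_policy
      by (simp add: maximizes_performance_def performance_adaptive_policy[OF c(2)])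
    moreover have "K \<le> performance (bandit_instance c) (adaptive_policy c) -
        performance (bandit_instance c) \<pi>'" if "markovian (bandit_instance c) \<pi>'" for \<pi>'
      using c(3) by (simp add: performance_adaptive_policy[OF c(2)]
          performance_markovian[OF c(2) that])
    ultimately show ?thesis
      using valid_bandit_instance strictly_uncertainty_adaptive_adaptive_policy[OF c(2)] by blast
  qed
  \<comment> \<open>The first conjunct is \<open>gap\<close> at an arbitrary \<open>K\<close>, with
    the bound dropped.\<close>
  then show ?thesis by blast
qed

end
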